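(* Let $\mathbb{F}$ be a field and let $\alpha,\beta\in\mathbb{F}$ with $1,\alpha,\beta$ pairwise distinct. Let $A$ be a $\mathcal{J}(\alpha,\beta)$-axial algebra over $\mathbb{F}$ generated by primitive axes $a,b$. Then $A$ is spanned by $a,\ b,\ \tau_a(b)$, or equivalently by $a,\ b,\ ab$. Moreover, if $b=\delta a+b_\alpha+b_\beta$ where $\delta\in\mathbb{F}$, $b_\alpha\in A_\alpha(a)$, $b_\beta\in A_\beta(a)$, then $$A_\alpha(a)=\langle(\beta-1)\delta a-\beta b+ab\rangle,\qquad A_\beta(a)=\langle(\alpha-1)\delta a-\alpha b+ab\rangle.$$
   Context: Algebras are commutative but not necessarily associative. For an element $a$ of an $\mathbb{F}$-algebra $A$ and $\lambda\in\mathbb{F}$, $A_\lambda(a)=\{x\in A: ax=\lambda x\}$ (possibly zero). $\langle\ldots\rangle$ denotes linear span. A $\mathcal{J}(\alpha,\beta)$-axis is a nonzero idempotent $a\in A$ such that $A=A_1(a)\oplus A_\alpha(a)\oplus A_\beta(a)$ and the fusion law holds: $A_1(a)A_\lambda(a)\subseteq A_\lambda(a)$ for $\lambda\in\{1,\alpha,\beta\}$, $A_\alpha(a)A_\alpha(a)\subseteq A_1(a)\oplus A_\alpha(a)$, $A_\alpha(a)A_\beta(a)\subseteq A_\beta(a)$, $A_\beta(a)A_\beta(a)\subseteq A_1(a)\oplus A_\alpha(a)$. "Axis" means $\mathcal{J}(\alpha,\beta)$-axis. An axis $a$ is primitive if $A_1(a)=\langle a\rangle$. A $\mathcal{J}(\alpha,\beta)$-axial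 algebra is a commutative algebra generated (as an algebra) by a set of $\mathcal{J}(\alpha,\beta)$-axes. For an axis $a$, the Miyamoto involution $\tau_a$ is the automorphism of $A$ acting as $+1$ on $A_1(a)\oplus A_\alpha(a)$ and as $-1$ on $A_\beta(a)$. *)

theory Defs
  imports Main HOL.Vector_Spaces "HOL-Library.Set_Algebras"
begin

locale comm_algebra = vector_space scale
  for scale :: "'f::field \<Rightarrow> 'a::ab_group_add \<Rightarrow> 'a" (infixr "*s" 75) +
  fixes mul :: "'a \<Rightarrow> 'a \<Rightarrow> 'a" (infixl "\<bullet>" 70)
  assumes mul_commute: "x \<bullet> y = y \<bullet> x"
    and mul_add_right: "x \<bullet> (y + z) = x \<bullet> y + x \<bullet> z"
    and mul_scale_right: "x \<bullet> (c *s y) = c *s (x \<bullet> y)"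
begin

definition subalgebra :: "'a set \<Rightarrow> bool" where
  "subalgebra S \<longleftrightarrow> subspace S \<and> (\<forall>x\<in>S. \<forall>y\<in>S. x \<bullet> y \<in> S)"

definition automorphism :: "('a \<Rightarrow> 'a) \<Rightarrow> bool" where
  "automorphism f \<longleftrightarrow>
     Vector_Spaces.linear scale scale f \<and> bij f \<and> (\<forall>x y. f (x \<bullet> y) = f x \<bullet> f y)"

definition eigenspace :: "'a \<Rightarrow> 'f \<Rightarrow> 'a set" where
  "eigenspace a c = {x. a \<bullet> x = c *s x}"

definition set_mul :: "'a set \<Rightarrow> 'a set \<Rightarrow> 'a set" where
  "set_mul X Y = {x \<bullet> y | x y. x \<in> X \<and> y \<in> Y}"

text \<open>
  The unique-decomposition clause says that the whole algebra is the internal direct sum of the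
  three eigenspaces.  In the fusion law, \<^const>\<open>set_mul\<close> is the set of products rather than its
  span; the right-hand sides are subspaces, so this makes no difference.
\<close>

definition axis :: "'f \<Rightarrow> 'f \<Rightarrow> 'a \<Rightarrow> bool" where
  "axis \<alpha> \<beta> a \<longleftrightarrow>
     a \<noteq> 0 \<and> a \<bullet> a = a \<and>
     (\<forall>x. \<exists>!(u, v, w). u \<in> eigenspace a 1 \<and> v \<in> eigenspace a \<alpha> \<and> w \<in> eigenspace a \<beta>
            \<and> x = u + v + w) \<and>
     (\<forall>c\<in>{1, \<alpha>, \<beta>}. set_mul (eigenspace a 1) (eigenspace a c) \<subseteq> eigenspace a c) \<and>
     set_mul (eigenspace a \<alpha>) (eigenspace a \<alpha>) \<subseteq> eigenspace a 1 + eigenspace a \<alpha> \<and>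
     set_mul (eigenspace a \<alpha>) (eigenspace a \<beta>) \<subseteq> eigenspace a \<beta> \<and>
     set_mul (eigenspace a \<beta>) (eigenspace a \<beta>) \<subseteq> eigenspace a 1 + eigenspace a \<alpha>"

definition primitive_axis :: "'f \<Rightarrow> 'f \<Rightarrow> 'a \<Rightarrow> bool" where
  "primitive_axis \<alpha> \<beta> a \<longleftrightarrow> axis \<alpha> \<beta> a \<and> eigenspace a 1 = span {a}"

definition axial_algebra_generated_by :: "'f \<Rightarrow> 'f \<Rightarrow> 'a set \<Rightarrow> bool" where
  "axial_algebra_generated_by \<alpha> \<beta> X \<longleftrightarrow> (\<forall>x\<in>X. axis \<alpha> \<beta> x) \<and> subalgebra hull X = UNIV"

text \<open>
  Existence and uniqueness of the automorphism described here, for every axis, are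
  \<open>miyamoto_ex1\<close> below.
\<close>

definition miyamoto :: "'f \<Rightarrow> 'f \<Rightarrow> 'a \<Rightarrow> ('a \<Rightarrow> 'a)" where
  "miyamoto \<alpha> \<beta> a = (THE f. automorphism f \<and>
     (\<forall>x \<in> eigenspace a 1 + eigenspace a \<alpha>. f x = x) \<and>
     (\<forall>x \<in> eigenspace a \<beta>. f x = - x))"

lemma mul_add_left: "(x + y) \<bullet> z = x \<bullet> z + y \<bullet> z"
  using mul_add_right mul_commute by metis

lemma mul_minus_right: "x \<bullet> (- y) = - (x \<bullet> y)"
  using mul_scale_right[of x "-1" y] by simp

lemma mul_minus_left: "(- x) \<bullet> y = - (x \<bullet> y)"
  using mul_minus_right mul_commute by metis

lemma subspace_eigenspace: "subspace (eigenspace a c)"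
  by (rule subspaceI)
    (use mul_scale_right[of a 0 0] in
      \<open>auto simp: eigenspace_def mul_add_right mul_scale_right scale_right_distrib scale_left_commute\<close>)

lemma miyamoto_ex1:
  assumes "axis \<alpha> \<beta> a"
  shows "\<exists>!f. automorphism f \<and>
     (\<forall>x \<in> eigenspace a 1 + eigenspace a \<alpha>. f x = x) \<and>
     (\<forall>x \<in> eigenspace a \<beta>. f x = - x)"
proof -
  let ?P = "eigenspace a 1 + eigenspace a \<alpha>" and ?N = "eigenspace a \<beta>"
  note E = subspace_eigenspace[of a]
  have sP: "subspace ?P"
    using subspace_sums[OF E[of 1] E[of \<alpha>]]
    by (rule back_subst[of subspace]) (auto simp: set_plus_def)
  have mulD: "x \<bullet> y \<in> Z" if "set_mul X Y \<subseteq> Z" "x \<in> X" "y \<in> Y" for x y X Y Z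
    using that unfolding set_mul_def by blast
  have dec: "\<forall>x. \<exists>!(u, v, w). u \<in> eigenspace a 1 \<and> v \<in> eigenspace a \<alpha> \<and> w \<in> ?N \<and> x = u + v + w"
    and f1: "\<forall>c\<in>{1, \<alpha>, \<beta>}. set_mul (eigenspace a 1) (eigenspace a c) \<subseteq> eigenspace a c"
    and faa: "set_mul (eigenspace a \<alpha>) (eigenspace a \<alpha>) \<subseteq> ?P"
    and fab: "set_mul (eigenspace a \<alpha>) ?N \<subseteq> ?N"
    and NN: "set_mul ?N ?N \<subseteq> ?P"
    using assms unfolding axis_def by simp_all
  note f1 = mulD[OF f1[rule_format]] and faa = mulD[OF faa]
    and fab = mulD[OF fab] and NN = mulD[OF NN]
  have exd: "\<exists>p\<in>?P. \<exists>n\<in>?N. x = p + n" for x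
    using dec[rule_format, of x] by (auto simp: set_plus_def)
  have und: "p = q" "n = m" if h: "p \<in> ?P" "q \<in> ?P" "n \<in> ?N" "m \<in> ?N" "p + n = q + m" for p q n m
  proof -
    obtain u v u' v' where *: "u \<in> eigenspace a 1" "v \<in> eigenspace a \<alpha>" "p = u + v"
       "u' \<in> eigenspace a 1" "v' \<in> eigenspace a \<alpha>" "q = u' + v'"
      using h(1,2) by (elim set_plus_elim) blast
    from dec[rule_format, of "p + n"] obtain t where
      t: "\<And>s. (case s of (u, v, w) \<Rightarrow> u \<in> eigenspace a 1 \<and> v \<in> eigenspace a \<alpha> \<and> w \<in> ?N
            \<and> p + n = u + v + w) \<Longrightarrow> s = t"
      by (elim ex1E) blast
    have "(u, v, n) = t" "(u', v', m) = t"
      using * h by (intro t; simp)+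
    then have "(u, v, n) = (u', v', m)" by simp
    then show "p = q" "n = m" using * by auto
  qed
  have sub1: "x \<in> ?P" if "x \<in> eigenspace a 1 \<or> x \<in> eigenspace a \<alpha>" for x
    using that subspace_0[OF E[of 1]] subspace_0[OF E[of \<alpha>]] by (force simp: set_plus_def)
  have PN: "x \<bullet> y \<in> ?N" if "x \<in> ?P" "y \<in> ?N" for x y
    using that f1[of \<beta>] fab subspace_add[OF E[of \<beta>]] by (auto simp: set_plus_def mul_add_left)
  have PP: "x \<bullet> y \<in> ?P" if xy: "x \<in> ?P" "y \<in> ?P" for x y
  proof -
    obtain u v u' v' where *: "u \<in> eigenspace a 1" "v \<in> eigenspace a \<alpha>" "x = u + v"
       "u' \<in> eigenspace a 1" "v' \<in> eigenspace a \<alpha>" "y = u' + v'"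
      using xy by (elim set_plus_elim) blast
    have "u \<bullet> u' \<in> ?P" "u \<bullet> v' \<in> ?P" "v \<bullet> v' \<in> ?P" "u' \<bullet> v \<in> ?P"
      using * f1[of 1] f1[of \<alpha>] faa sub1 by auto
    then show ?thesis
      using * by (simp add: mul_add_left mul_add_right subspace_add[OF sP] mul_commute[of v u'])
  qed
  define pr where "pr x = (THE p. p \<in> ?P \<and> (\<exists>n\<in>?N. x = p + n))" for x
  define f where "f x = pr x + pr x - x" for x
  have pr: "pr (p + n) = p" if "p \<in> ?P" "n \<in> ?N" for p n
    unfolding pr_def by (rule the_equality) (use that und in blast)+
  have f: "f (p + n) = p - n" if "p \<in> ?P" "n \<in> ?N" for p n
    using pr[OF that] by (simp add: f_def)
  have fP: "f p = p" if "p \<in> ?P" for p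
    using f[OF that subspace_0[OF E]] by simp
  have fN: "f n = - n" if "n \<in> ?N" for n
    using f[OF subspace_0[OF sP] that] by simp
  have add: "f (x + y) = f x + f y" for x y
  proof -
    obtain p n q m where *: "p \<in> ?P" "n \<in> ?N" "x = p + n" "q \<in> ?P" "m \<in> ?N" "y = q + m"
      using exd by meson
    have "x + y = (p + q) + (n + m)" using * by (simp add: add_ac)
    moreover have "f ((p + q) + (n + m)) = (p + q) - (n + m)"
      using * by (intro f subspace_add[OF sP] subspace_add[OF E])
    ultimately show ?thesis
      using * by (simp only: f) (simp add: algebra_simps)
  qed
  have scl: "f (c *s x) = c *s f x" for c x
  proof -
    obtain p n where *: "p \<in> ?P" "n \<in> ?N" "x = p + n"
      using exd by meson
    then show ?thesis
      using f[OF subspace_scale[OF sP, of p c] subspace_scale[OF E, of n \<beta> c]]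
      by (simp add: f scale_right_distrib scale_right_diff_distrib)
  qed
  have ml: "f (x \<bullet> y) = f x \<bullet> f y" for x y
  proof -
    obtain p n q m where *: "p \<in> ?P" "n \<in> ?N" "x = p + n" "q \<in> ?P" "m \<in> ?N" "y = q + m"
      using exd by meson
    have "p \<bullet> q + n \<bullet> m \<in> ?P" "p \<bullet> m + q \<bullet> n \<in> ?N"
      using * PP PN NN subspace_add[OF sP] subspace_add[OF E] by auto
    from f[OF this] have "f ((p \<bullet> q + n \<bullet> m) + (p \<bullet> m + q \<bullet> n)) = (p \<bullet> q + n \<bullet> m) - (p \<bullet> m + q \<bullet> n)" .
    moreover have "x \<bullet> y = (p \<bullet> q + n \<bullet> m) + (p \<bullet> m + q \<bullet> n)"
      using * by (simp add: mul_add_left mul_add_right mul_commute[of n q] add_ac)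
    moreover have "(p - n) \<bullet> (q - m) = (p \<bullet> q + n \<bullet> m) - (p \<bullet> m + q \<bullet> n)"
      unfolding diff_conv_add_uminus
      by (simp add: mul_add_left mul_add_right mul_minus_left mul_minus_right mul_commute[of n q]
          add_ac del: add_uminus_conv_diff)
    ultimately show ?thesis
      using * by (simp only: f)
  qed
  have "f (f x) = x" for x
  proof -
    obtain p n where *: "p \<in> ?P" "n \<in> ?N" "x = p + n"
      using exd by meson
    then show ?thesis
      using f[of p "- n"] subspace_neg[OF E] by (simp add: f)
  qed
  then have "bij f" by (metis bijI')
  moreover have "Vector_Spaces.linear scale scale f"
    by (intro linear_iff[THEN iffD2] conjI allI vector_space_axioms add scl)
  ultimately have aut: "automorphism f"
    using ml by (simp add: automorphism_def)
  show ?thesis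
  proof (rule ex1I[of _ f])
    show "automorphism f \<and> (\<forall>x \<in> ?P. f x = x) \<and> (\<forall>x \<in> ?N. f x = - x)"
      using aut fP fN by blast
  next
    fix g
    assume g: "automorphism g \<and> (\<forall>x \<in> ?P. g x = x) \<and> (\<forall>x \<in> ?N. g x = - x)"
    then have ga: "g (x + y) = g x + g y" for x y
      unfolding automorphism_def linear_iff by blast
    show "g = f"
    proof
      fix x
      obtain p n where "p \<in> ?P" "n \<in> ?N" "x = p + n"
        using exd by meson
      then show "g x = f x" using g by (simp add: ga f)
    qed
  qed
qed

end

end

theory Submission
  imports Defs
begin

text \<open>
  Write \<open>b = \<delta> a + v + w\<close> with \<open>v\<close>, \<open>w\<close> in the \<open>\<alpha>\<close>- and \<open>\<beta>\<close>-eigenspaces of \<open>a\<close>.  The span \<open>W\<close> of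
  \<open>a, b, ab\<close> equals the span of \<open>a, v, w\<close>, so it is stable under multiplication by \<open>a\<close>, and by
  symmetry under multiplication by \<open>b\<close>.  Comparing \<open>\<beta>\<close>-components in \<open>b\<^sup>2 = b\<close> gives
  \<open>2 vw = (1 - 2 \<delta> \<beta>) w\<close>, whence \<open>vw \<in> W\<close> (in characteristic 2 this identity forces \<open>w = 0\<close>).
  Up to nonzero scalars, \<open>v\<close> and \<open>w\<close> are of the form \<open>ab\<close> plus a combination of \<open>a\<close> and \<open>b\<close>, so
  \<open>vw \<in> W\<close> amounts to \<open>(ab)(ab) \<in> W\<close>.  Hence \<open>W\<close> is a subalgebra, that is, the whole algebra.
\<close>

context comm_algebra
begin

section \<open>Bilinearity and products of spans\<close>

lemma mul_scale_left: "(c *s x) \<bullet> y = c *s (x \<bullet> y)"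
  using mul_scale_right mul_commute by metis

lemma subspace_mul_vimage:
  assumes "subspace S"
  shows "subspace {x. y \<bullet> x \<in> S}"
  by (rule subspaceI)
    (use assms mul_scale_right[of y 0 0] in
      \<open>auto simp: mul_add_right mul_scale_right subspace_0 subspace_add subspace_scale\<close>)

lemma span_mul_right:
  assumes "x \<in> span X" "subspace S" "\<And>z. z \<in> X \<Longrightarrow> y \<bullet> z \<in> S"
  shows "y \<bullet> x \<in> S"
  using span_minimal[of X "{x. y \<bullet> x \<in> S}"] subspace_mul_vimage[OF assms(2)] assms by blast

lemma span_mul:
  assumes "x \<in> span X" "y \<in> span Y" "subspace S" "\<And>u v. u \<in> X \<Longrightarrow> v \<in> Y \<Longrightarrow> u \<bullet> v \<in> S"
  shows "x \<bullet> y \<in> S"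
proof (rule span_mul_right[OF assms(2,3)])
  show "x \<bullet> v \<in> S" if "v \<in> Y" for v
    using span_mul_right[OF assms(1,3), of v] assms(4) that mul_commute by metis
qed

lemma scale_double: "(2 * c) *s x = c *s x + c *s x"
  by (simp only: mult_2 scale_left_distrib)

lemma span_singleton_scale:
  assumes "c \<noteq> 0"
  shows "span {c *s x} = span {x}"
proof (rule span_eq[THEN iffD2], intro conjI)
  show "{c *s x} \<subseteq> span {x}"
    by (simp add: span_base span_scale)
  have "inverse c *s (c *s x) \<in> span {c *s x}"
    by (intro span_scale span_base) simp
  then show "{x} \<subseteq> span {c *s x}"
    using assms by simp
qed

section \<open>Decomposition along the eigenspaces of an axis\<close>

lemma axis_decomposition:
  assumes "axis \<alpha> \<beta> a"
  obtains u v w where "u \<in> eigenspace a 1" "v \<in> eigenspace a \<alpha>" "w \<in> eigenspace a \<beta>"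
    "x = u + v + w"
proof -
  have "\<exists>!(u, v, w). u \<in> eigenspace a 1 \<and> v \<in> eigenspace a \<alpha> \<and> w \<in> eigenspace a \<beta> \<and> x = u + v + w"
    using assms unfolding axis_def by blast
  then show ?thesis
    using that by auto
qed

lemma axis_decomposition_unique:
  assumes "axis \<alpha> \<beta> a"
    and "u \<in> eigenspace a 1" "v \<in> eigenspace a \<alpha>" "w \<in> eigenspace a \<beta>"
    and "u' \<in> eigenspace a 1" "v' \<in> eigenspace a \<alpha>" "w' \<in> eigenspace a \<beta>"
    and "u + v + w = u' + v' + w'"
  shows "u = u'" "v = v'" "w = w'"
proof -
  let ?D = "\<lambda>(p, q, r). p \<in> eigenspace a 1 \<and> q \<in> eigenspace a \<alpha> \<and> r \<in> eigenspace a \<beta>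
    \<and> u + v + w = p + q + r"
  have "\<exists>!t. ?D t"
    using assms(1) unfolding axis_def by blast
  moreover have "?D (u, v, w)" "?D (u', v', w')"
    using assms by auto
  ultimately have "(u, v, w) = (u', v', w')"
    by blast
  then show "u = u'" "v = v'" "w = w'"
    by auto
qed

lemma primitive_axis_decomposition:
  assumes "primitive_axis \<alpha> \<beta> a"
  obtains \<delta> v w where "v \<in> eigenspace a \<alpha>" "w \<in> eigenspace a \<beta>" "x = \<delta> *s a + v + w"
proof -
  obtain u v w where "u \<in> eigenspace a 1" "v \<in> eigenspace a \<alpha>" "w \<in> eigenspace a \<beta>"
    "x = u + v + w"
    using assms axis_decomposition unfolding primitive_axis_def by metis
  moreover from this obtain \<delta> where "u = \<delta> *s a"
    using assms unfolding primitive_axis_def span_singleton by auto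
  ultimately show ?thesis
    using that by blast
qed

section \<open>Idempotence and products of components\<close>

lemma axis_idem: "axis \<alpha> \<beta> a \<Longrightarrow> a \<bullet> a = a"
  unfolding axis_def by blast

lemma scale_axis_in_eigenspace: "axis \<alpha> \<beta> a \<Longrightarrow> c *s a \<in> eigenspace a 1"
  by (simp add: eigenspace_def mul_scale_right axis_idem)

text \<open>By the fusion law \<open>v \<bullet> v\<close> and \<open>w \<bullet> w\<close> have no
  \<beta>-component, while \<open>v \<bullet> w\<close> is purely \<beta>. The \<beta>-part of
  \<open>b \<bullet> b\<close> therefore comes only from the mixed products
  \<open>a \<bullet> w\<close> and \<open>v \<bullet> w\<close>, each occurring twice.\<close>

lemma idempotent_component_product:
  assumes a: "axis \<alpha> \<beta> a" and b: "b \<bullet> b = b"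
    and v: "v \<in> eigenspace a \<alpha>" and w: "w \<in> eigenspace a \<beta>" and bd: "b = \<delta> *s a + v + w"
  shows "v \<bullet> w + v \<bullet> w = (1 - 2 * \<delta> * \<beta>) *s w"
proof -
  note E = subspace_eigenspace[of a]
  have av: "a \<bullet> v = \<alpha> *s v" "v \<bullet> a = \<alpha> *s v" and aw: "a \<bullet> w = \<beta> *s w" "w \<bullet> a = \<beta> *s w"
    using v w mul_commute unfolding eigenspace_def by auto
  have fusion: "v \<bullet> v \<in> eigenspace a 1 + eigenspace a \<alpha>" "v \<bullet> w \<in> eigenspace a \<beta>"
    "w \<bullet> w \<in> eigenspace a 1 + eigenspace a \<alpha>"
    using a v w unfolding axis_def set_mul_def by blast+
  from fusion(1) obtain p q where pq: "p \<in> eigenspace a 1" "q \<in> eigenspace a \<alpha>" "v \<bullet> v = p + q"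
    by (elim set_plus_elim)
  from fusion(3) obtain r s where rs: "r \<in> eigenspace a 1" "s \<in> eigenspace a \<alpha>" "w \<bullet> w = r + s"
    by (elim set_plus_elim)
  \<comment> \<open>The three brackets collect the components for 1, \<alpha> and \<beta>, ready for
    uniqueness of the decomposition.\<close>
  have "b \<bullet> b = ((\<delta> * \<delta>) *s a + p + r) + ((2 * (\<delta> * \<alpha>)) *s v + q + s)
      + ((2 * (\<delta> * \<beta>)) *s w + (v \<bullet> w + v \<bullet> w))"
    unfolding bd by (simp add: mul_add_left mul_add_right mul_scale_left mul_scale_right
        axis_idem[OF a] av aw pq(3) rs(3) mul_commute[of w v] scale_right_distrib
        scale_double add_ac)
  then have eq: "((\<delta> * \<delta>) *s a + p + r) + ((2 * (\<delta> * \<alpha>)) *s v + q + s)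
      + ((2 * (\<delta> * \<beta>)) *s w + (v \<bullet> w + v \<bullet> w)) = \<delta> *s a + v + w"
    using b bd by simp
  have "(2 * (\<delta> * \<beta>)) *s w + (v \<bullet> w + v \<bullet> w) = w"
    by (rule axis_decomposition_unique(3)[OF a _ _ _ _ _ _ eq])
      (use pq rs v w fusion(2) E scale_axis_in_eigenspace[OF a] in
        \<open>auto intro: subspace_add subspace_scale\<close>)
  then show ?thesis
    by (simp add: scale_left_diff_distrib algebra_simps)
qed

text \<open>When 2 = 0, the left side of \<open>idempotent_component_product\<close> vanishes and
  the coefficient on the right becomes 1.\<close>

lemma idempotent_component_char2:
  assumes "axis \<alpha> \<beta> a" "b \<bullet> b = b"
    and "v \<in> eigenspace a \<alpha>" "w \<in> eigenspace a \<beta>" "b = \<delta> *s a + v + w"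
    and "(2::'f) = 0"
  shows "w = 0"
proof -
  have "v \<bullet> w + v \<bullet> w = 2 *s (v \<bullet> w)"
    using scale_double[of 1 "v \<bullet> w"] by simp
  then show ?thesis
    using idempotent_component_product[OF assms(1-5)] assms(6) by simp
qed

lemma idempotent_component_product_in_span:
  assumes "axis \<alpha> \<beta> a" "b \<bullet> b = b"
    and "v \<in> eigenspace a \<alpha>" "w \<in> eigenspace a \<beta>" "b = \<delta> *s a + v + w"
  shows "v \<bullet> w \<in> span {w}"
proof (cases "(2::'f) = 0")
  case True
  then have "w = 0"
    using idempotent_component_char2 assms by blast
  then show ?thesis
    using mul_scale_right[of v 0 0] by simp
next
  case False
  have "2 *s (v \<bullet> w) = (1 - 2 * \<delta> * \<beta>) *s w"
    using idempotent_component_product[OF assms] scale_double[of 1 "v \<bullet> w"] by simp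
  then have "inverse 2 *s (2 *s (v \<bullet> w)) = inverse 2 *s ((1 - 2 * \<delta> * \<beta>) *s w)"
    by simp
  then have "v \<bullet> w = inverse 2 *s ((1 - 2 * \<delta> * \<beta>) *s w)"
    using False by simp
  then show ?thesis
    by (simp add: span_base span_scale)
qed

section \<open>Spans of components and closure under multiplication\<close>

lemma axis_component_eqs:
  assumes "axis \<alpha> \<beta> a"
    and v: "v \<in> eigenspace a \<alpha>" and w: "w \<in> eigenspace a \<beta>" and b: "b = \<delta> *s a + v + w"
  shows "((\<beta> - 1) * \<delta>) *s a - \<beta> *s b + a \<bullet> b = (\<alpha> - \<beta>) *s v"
    and "((\<alpha> - 1) * \<delta>) *s a - \<alpha> *s b + a \<bullet> b = (\<beta> - \<alpha>) *s w"
proof -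
  have "a \<bullet> b = \<delta> *s a + \<alpha> *s v + \<beta> *s w"
    using v w axis_idem[OF assms(1)] unfolding b eigenspace_def
    by (simp add: mul_add_right mul_scale_right)
  \<comment> \<open>Subtracting \<open>\<beta> *s b\<close> cancels \<open>w\<close>, subtracting
    \<open>\<alpha> *s b\<close> cancels \<open>v\<close>; the first summand then removes what is
    left of \<open>a\<close>.\<close>
  then show "((\<beta> - 1) * \<delta>) *s a - \<beta> *s b + a \<bullet> b = (\<alpha> - \<beta>) *s v"
    and "((\<alpha> - 1) * \<delta>) *s a - \<alpha> *s b + a \<bullet> b = (\<beta> - \<alpha>) *s w"
    unfolding b by (simp_all add: algebra_simps)
qed

lemma span_axis_components:
  assumes a: "axis \<alpha> \<beta> a" and "\<alpha> \<noteq> \<beta>"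
    and v: "v \<in> eigenspace a \<alpha>" and w: "w \<in> eigenspace a \<beta>" and b: "b = \<delta> *s a + v + w"
  shows "span {a, b, a \<bullet> b} = span {a, v, w}"
proof (rule span_eq[THEN iffD2], intro conjI)
  have ab: "a \<bullet> b = \<delta> *s a + \<alpha> *s v + \<beta> *s w"
    using v w axis_idem[OF a] unfolding b eigenspace_def
    by (simp add: mul_add_right mul_scale_right)
  show "{a, b, a \<bullet> b} \<subseteq> span {a, v, w}"
    unfolding ab by (auto simp: b intro!: span_add span_scale intro: span_base)
  let ?W = "span {a, b, a \<bullet> b}"
  have "(\<alpha> - \<beta>) *s v \<in> ?W" "(\<beta> - \<alpha>) *s w \<in> ?W"
    unfolding axis_component_eqs[OF a v w b, symmetric]
    by (auto intro!: span_add span_diff span_scale intro: span_base)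
  then show "{a, v, w} \<subseteq> ?W"
    \<comment> \<open>Since \<alpha> and \<beta> differ, the scalars can be inverted to recover
      \<open>v\<close> and \<open>w\<close> themselves.\<close>
    using span_scale[of "(\<alpha> - \<beta>) *s v" _ "inverse (\<alpha> - \<beta>)"]
      span_scale[of "(\<beta> - \<alpha>) *s w" _ "inverse (\<beta> - \<alpha>)"] \<open>\<alpha> \<noteq> \<beta>\<close>
    by (auto intro: span_base)
qed

text \<open>Multiplication by \<open>a\<close> scales each of the spanning vectors \<open>a\<close>,
  \<open>v\<close>, \<open>w\<close>. The element \<open>b\<close> is arbitrary, so that the roles
  of the two axes can later be exchanged.\<close>

lemma primitive_axis_mul_span:
  assumes a: "primitive_axis \<alpha> \<beta> a" and "\<alpha> \<noteq> \<beta>" and x: "x \<in> span {a, b, a \<bullet> b}"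
  shows "a \<bullet> x \<in> span {a, b, a \<bullet> b}"
proof -
  have ax: "axis \<alpha> \<beta> a"
    using a unfolding primitive_axis_def by blast
  obtain \<delta> v w where d: "v \<in> eigenspace a \<alpha>" "w \<in> eigenspace a \<beta>" "b = \<delta> *s a + v + w"
    by (rule primitive_axis_decomposition[OF a])
  note W = span_axis_components[OF ax \<open>\<alpha> \<noteq> \<beta>\<close> d]
  show ?thesis
    unfolding W
  proof (rule span_mul_right[OF x[unfolded W] subspace_span])
    show "a \<bullet> z \<in> span {a, v, w}" if "z \<in> {a, v, w}" for z
      using that d(1,2) axis_idem[OF ax] unfolding eigenspace_def
      by (auto intro!: span_scale intro: span_base)
  qed
qed

text \<open>This is the one product of spanning vectors without a factor \<open>a\<close> or
  \<open>b\<close>; it is extracted from \<open>v \<bullet> w\<close>.\<close>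

lemma primitive_axes_span_mul_square:
  assumes a: "primitive_axis \<alpha> \<beta> a" and b: "primitive_axis \<alpha> \<beta> b" and "\<alpha> \<noteq> \<beta>"
  shows "(a \<bullet> b) \<bullet> (a \<bullet> b) \<in> span {a, b, a \<bullet> b}" (is "_ \<in> ?W")
proof -
  have axes: "axis \<alpha> \<beta> a" "axis \<alpha> \<beta> b"
    using a b unfolding primitive_axis_def by blast+
  obtain \<delta> v w where d: "v \<in> eigenspace a \<alpha>" "w \<in> eigenspace a \<beta>" "b = \<delta> *s a + v + w"
    by (rule primitive_axis_decomposition[OF a])
  \<comment> \<open>Chosen so that \<open>x + a \<bullet> b\<close> and
    \<open>y + a \<bullet> b\<close> are the multiples of \<open>v\<close> and \<open>w\<close> from
    \<open>axis_component_eqs\<close>, with \<open>x\<close> and \<open>y\<close> in the span of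
    \<open>a\<close> and \<open>b\<close>.\<close>
  define x where "x = ((\<beta> - 1) * \<delta>) *s a - \<beta> *s b"
  define y where "y = ((\<alpha> - 1) * \<delta>) *s a - \<alpha> *s b"
  have mul_b: "b \<bullet> z \<in> ?W" if "z \<in> ?W" for z
    using primitive_axis_mul_span[OF b \<open>\<alpha> \<noteq> \<beta>\<close>, of z a] that
    by (simp add: insert_commute mul_commute[of b a])
  have mul_xy: "t \<bullet> z \<in> ?W" if "t \<in> span {a, b}" "z \<in> ?W" for t z
  proof (rule span_mul[OF that subspace_span])
    show "u \<bullet> s \<in> ?W" if "u \<in> {a, b}" "s \<in> {a, b, a \<bullet> b}" for u s
      using that(1) mul_b[OF span_base[OF that(2)]]
        primitive_axis_mul_span[OF a \<open>\<alpha> \<noteq> \<beta>\<close> span_base[OF that(2)]] by blast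
  qed
  have xy: "x \<in> span {a, b}" "y \<in> span {a, b}"
    unfolding x_def y_def by (auto intro!: span_diff span_scale intro: span_base)
  have "v \<bullet> w \<in> span {a, v, w}"
    using idempotent_component_product_in_span[OF axes(1) axis_idem[OF axes(2)] d]
      span_mono[of "{w}" "{a, v, w}"] by blast
  then have "v \<bullet> w \<in> ?W"
    by (simp add: span_axis_components[OF axes(1) \<open>\<alpha> \<noteq> \<beta>\<close> d])
  then have P: "(x + a \<bullet> b) \<bullet> (y + a \<bullet> b) \<in> ?W"
    unfolding x_def y_def axis_component_eqs[OF axes(1) d]
    by (simp add: mul_scale_left mul_scale_right span_scale)
  \<comment> \<open>Every subtracted term has a factor in the span of \<open>a\<close> and
    \<open>b\<close>, and such factors preserve \<open>?W\<close>.\<close>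
  have "(a \<bullet> b) \<bullet> (a \<bullet> b) =
      (x + a \<bullet> b) \<bullet> (y + a \<bullet> b) - x \<bullet> (a \<bullet> b) - y \<bullet> (a \<bullet> b) - x \<bullet> y"
    by (simp add: mul_add_left mul_add_right mul_commute[of "a \<bullet> b" y])
  moreover have "y \<in> ?W"
    using xy(2) span_mono[of "{a, b}" "{a, b, a \<bullet> b}"] by blast
  ultimately show ?thesis
    using P xy mul_xy by (auto intro!: span_diff simp: span_base)
qed

lemma primitive_axes_span_subalgebra:
  assumes a: "primitive_axis \<alpha> \<beta> a" and b: "primitive_axis \<alpha> \<beta> b" and "\<alpha> \<noteq> \<beta>"
  shows "subalgebra (span {a, b, a \<bullet> b})" (is "subalgebra ?W")
  unfolding subalgebra_def
proof (intro conjI ballI subspace_span)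
  have mul_a: "a \<bullet> z \<in> ?W" if "z \<in> ?W" for z
    using primitive_axis_mul_span[OF a \<open>\<alpha> \<noteq> \<beta>\<close> that] .
  have mul_b: "b \<bullet> z \<in> ?W" if "z \<in> ?W" for z
    using primitive_axis_mul_span[OF b \<open>\<alpha> \<noteq> \<beta>\<close>, of z a] that
    by (simp add: insert_commute mul_commute[of b a])
  fix x y
  assume xy: "x \<in> ?W" "y \<in> ?W"
  show "x \<bullet> y \<in> ?W"
  proof (rule span_mul[OF xy subspace_span])
    show "u \<bullet> v \<in> ?W" if uv: "u \<in> {a, b, a \<bullet> b}" "v \<in> {a, b, a \<bullet> b}" for u v
    proof -
      have "u \<in> ?W" "v \<in> ?W"
        using uv by (auto intro: span_base)
      moreover consider "u = a" | "u = b" | "v = a" | "v = b" | "u = a \<bullet> b" "v = a \<bullet> b"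
        using uv by blast
      ultimately show ?thesis
        by cases (metis mul_a mul_b mul_commute primitive_axes_span_mul_square[OF assms])+
    qed
  qed
qed

section \<open>Consequences of generation: spanning sets and eigenspaces\<close>

lemma axial_algebra_span_UNIV:
  assumes "primitive_axis \<alpha> \<beta> a" "primitive_axis \<alpha> \<beta> b" "\<alpha> \<noteq> \<beta>"
    and "axial_algebra_generated_by \<alpha> \<beta> {a, b}"
  shows "span {a, b, a \<bullet> b} = UNIV"
proof -
  have "subalgebra hull {a, b} \<subseteq> span {a, b, a \<bullet> b}"
    using primitive_axes_span_subalgebra[OF assms(1-3)]
    by (intro hull_minimal) (auto intro: span_base)
  then show ?thesis
    using assms(4) unfolding axial_algebra_generated_by_def by auto
qed

text \<open>A combination of \<open>a\<close>, \<open>v\<close>, \<open>w\<close> displays its own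
  components, so by uniqueness an eigenvector keeps only the matching term. If \<open>v\<close> or
  \<open>w\<close> is 0, the corresponding eigenspace is zero.\<close>

lemma eigenspaces_of_span_UNIV:
  assumes a: "axis \<alpha> \<beta> a" and v: "v \<in> eigenspace a \<alpha>" and w: "w \<in> eigenspace a \<beta>"
    and U: "span {a, v, w} = UNIV"
  shows "eigenspace a \<alpha> = span {v}" "eigenspace a \<beta> = span {w}"
proof -
  note E = subspace_eigenspace[of a]
  have comb: "\<exists>c d e. x = c *s a + d *s v + e *s w" for x
  proof -
    have "x \<in> span {a, v, w}"
      using U by simp
    then obtain c d e where "x - c *s a - d *s v = e *s w"
      unfolding span_insert span_singleton by auto
    then have "x = c *s a + d *s v + e *s w"
      by (simp add: algebra_simps)
    then show ?thesis
      by blast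
  qed
  have "x \<in> span {v}" if x: "x \<in> eigenspace a \<alpha>" for x
  proof -
    obtain c d e where "x = c *s a + d *s v + e *s w"
      using comb by blast
    \<comment> \<open>The zeros stand for the missing components of the eigenvector
      \<open>x\<close>.\<close>
    then have eq: "0 + x + 0 = c *s a + d *s v + e *s w"
      by simp
    have "x = d *s v"
      by (rule axis_decomposition_unique(2)[OF a _ _ _ _ _ _ eq])
        (use x v w in \<open>auto intro: subspace_0[OF E] subspace_scale[OF E]
          scale_axis_in_eigenspace[OF a]\<close>)
    then show ?thesis
      by (simp add: span_base span_scale)
  qed
  then show "eigenspace a \<alpha> = span {v}"
    using span_minimal[of "{v}", OF _ E] v by auto
  have "x \<in> span {w}" if x: "x \<in> eigenspace a \<beta>" for x
  proof -
    obtain c d e where "x = c *s a + d *s v + e *s w"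
      using comb by blast
    then have eq: "0 + 0 + x = c *s a + d *s v + e *s w"
      by simp
    have "x = e *s w"
      by (rule axis_decomposition_unique(3)[OF a _ _ _ _ _ _ eq])
        (use x v w in \<open>auto intro: subspace_0[OF E] subspace_scale[OF E]
          scale_axis_in_eigenspace[OF a]\<close>)
    then show ?thesis
      by (simp add: span_base span_scale)
  qed
  then show "eigenspace a \<beta> = span {w}"
    using span_minimal[of "{w}", OF _ E] w by auto
qed

text \<open>The definite description denotes by \<open>miyamoto_ex1\<close>; additivity then gives
  the value on a sum of components.\<close>

lemma miyamoto_apply:
  assumes a: "axis \<alpha> \<beta> a"
    and "u \<in> eigenspace a 1" "v \<in> eigenspace a \<alpha>" "w \<in> eigenspace a \<beta>"
  shows "miyamoto \<alpha> \<beta> a (u + v + w) = u + v - w"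
proof -
  let ?t = "miyamoto \<alpha> \<beta> a"
  have t: "automorphism ?t \<and> (\<forall>x \<in> eigenspace a 1 + eigenspace a \<alpha>. ?t x = x) \<and>
     (\<forall>x \<in> eigenspace a \<beta>. ?t x = - x)"
    unfolding miyamoto_def by (rule theI'[OF miyamoto_ex1[OF a]])
  then have "?t (u + v + w) = ?t (u + v) + ?t w"
    unfolding automorphism_def linear_iff by blast
  moreover have "u + v \<in> eigenspace a 1 + eigenspace a \<alpha>"
    using assms by (intro set_plus_intro)
  ultimately show ?thesis
    using t assms by simp
qed

text \<open>The difference of \<open>b\<close> and its Miyamoto image is \<open>2 *s w\<close>. This
  yields \<open>w\<close> by division, except in characteristic 2, where idempotence of
  \<open>b\<close> forces \<open>w = 0\<close>. Then \<open>v\<close> is what remains of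
  \<open>b\<close>.\<close>

lemma span_miyamoto:
  assumes a: "axis \<alpha> \<beta> a" and "b \<bullet> b = b"
    and v: "v \<in> eigenspace a \<alpha>" and w: "w \<in> eigenspace a \<beta>" and b: "b = \<delta> *s a + v + w"
  shows "span {a, v, w} \<subseteq> span {a, b, miyamoto \<alpha> \<beta> a b}" (is "_ \<subseteq> ?M")
proof (rule span_minimal[OF _ subspace_span])
  have M: "a \<in> ?M" "b \<in> ?M" "miyamoto \<alpha> \<beta> a b \<in> ?M"
    by (auto intro: span_base)
  have "miyamoto \<alpha> \<beta> a b = \<delta> *s a + v - w"
    unfolding b by (rule miyamoto_apply[OF a scale_axis_in_eigenspace[OF a] v w])
  then have "b - miyamoto \<alpha> \<beta> a b = 2 *s w"
    using scale_double[of 1 w] by (simp add: b)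
  then have w2: "2 *s w \<in> ?M"
    using span_diff[OF M(2,3)] by simp
  have wM: "w \<in> ?M"
  proof (cases "(2::'f) = 0")
    case True
    then have "w = 0"
      using idempotent_component_char2 assms by blast
    then show ?thesis
      by (simp add: span_zero)
  next
    case False
    then show ?thesis
      using span_scale[OF w2, of "inverse 2"] by simp
  qed
  have "v = b - \<delta> *s a - w"
    by (simp add: b)
  then have "v \<in> ?M"
    using M(1,2) wM by (auto intro: span_diff span_scale)
  then show "{a, v, w} \<subseteq> ?M"
    using M wM by blast
qed

end

theorem proposition1:
  fixes scale :: "'f::field \<Rightarrow> 'a::ab_group_add \<Rightarrow> 'a" (infixr "*s" 75)
    and mul :: "'a \<Rightarrow> 'a \<Rightarrow> 'a" (infixl "\<bullet>" 70)
    and \<alpha> \<beta> :: 'f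
    and a b :: 'a
  assumes "comm_algebra scale mul"
    and "\<alpha> \<noteq> 1" and "\<beta> \<noteq> 1" and "\<alpha> \<noteq> \<beta>"
    and "comm_algebra.primitive_axis scale mul \<alpha> \<beta> a"
    and "comm_algebra.primitive_axis scale mul \<alpha> \<beta> b"
    and "comm_algebra.axial_algebra_generated_by scale mul \<alpha> \<beta> {a, b}"
  shows "module.span scale {a, b, comm_algebra.miyamoto scale mul \<alpha> \<beta> a b} = UNIV
    \<and> module.span scale {a, b, a \<bullet> b} = UNIV
    \<and> (\<forall>\<delta>. \<forall>b\<^sub>\<alpha> \<in> comm_algebra.eigenspace scale mul a \<alpha>.
        \<forall>b\<^sub>\<beta> \<in> comm_algebra.eigenspace scale mul a \<beta>.
          b = \<delta> *s a + b\<^sub>\<alpha> + b\<^sub>\<beta> \<longrightarrow>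
            comm_algebra.eigenspace scale mul a \<alpha> =
              module.span scale {((\<beta> - 1) * \<delta>) *s a - \<beta> *s b + a \<bullet> b}
          \<and> comm_algebra.eigenspace scale mul a \<beta> =
              module.span scale {((\<alpha> - 1) * \<delta>) *s a - \<alpha> *s b + a \<bullet> b})"
proof -
  interpret comm_algebra scale mul
    by fact
  note a = assms(5) and b = assms(6)
  have axes: "axis \<alpha> \<beta> a" "axis \<alpha> \<beta> b"
    using a b unfolding primitive_axis_def by blast+
  have W: "span {a, b, a \<bullet> b} = UNIV"
    using axial_algebra_span_UNIV[OF a b \<open>\<alpha> \<noteq> \<beta>\<close> assms(7)] .
  have components: "span {a, v, w} = UNIV"
    if "v \<in> eigenspace a \<alpha>" "w \<in> eigenspace a \<beta>" "b = \<delta> *s a + v + w" for \<delta> v w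
    using span_axis_components[OF axes(1) \<open>\<alpha> \<noteq> \<beta>\<close> that] W by simp
  obtain \<delta> v w where d: "v \<in> eigenspace a \<alpha>" "w \<in> eigenspace a \<beta>" "b = \<delta> *s a + v + w"
    by (rule primitive_axis_decomposition[OF a])
  have M: "span {a, b, miyamoto \<alpha> \<beta> a b} = UNIV"
    using span_miyamoto[OF axes(1) axis_idem[OF axes(2)] d] components[OF d] by auto
  \<comment> \<open>The stated generators are nonzero multiples of \<open>v\<close> and
    \<open>w\<close>, which span the eigenspaces for any decomposition of \<open>b\<close>.\<close>
  have "eigenspace a \<alpha> = span {((\<beta> - 1) * \<delta>) *s a - \<beta> *s b + a \<bullet> b}
      \<and> eigenspace a \<beta> = span {((\<alpha> - 1) * \<delta>) *s a - \<alpha> *s b + a \<bullet> b}"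
    if "v \<in> eigenspace a \<alpha>" "w \<in> eigenspace a \<beta>" "b = \<delta> *s a + v + w" for \<delta> v w
    unfolding axis_component_eqs[OF axes(1) that]
    using eigenspaces_of_span_UNIV[OF axes(1) that(1,2) components[OF that]] \<open>\<alpha> \<noteq> \<beta>\<close>
    by (simp add: span_singleton_scale)
  with W M show ?thesis
    by blast
qed

end
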